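(* Let $\mathbb{K}$ be an algebraically closed field of characteristic zero and let $$S = \frac{\mathbb{K} \langle x_1, x_2, x_3, x_4 \rangle}{\langle x_1x_2-x_3^2,\ x_4^2-x_2x_1,\ x_1x_3-x_2x_4,\ x_4x_1-x_3x_2,\ x_2x_3-x_3x_1,\ x_4x_2-x_1x_4 \rangle}.$$ Grade $S$ by the semidihedral group $SD_{16}$ of order 16 by assigning $x_1,x_2,x_3,x_4$ the group degrees $b, bc, ab, abcd$ respectively. Then the identity component (invariant subalgebra) $S_e$ is the subalgebra of $S$ generated by the set $Y=\{x_1^2,\ x_2^2,\ x_3x_4,\ x_4x_3\}$, and $S_e$ is isomorphic to $\mathbb{K}[z_1,z_2,z_3,z_4]$, the commutative polynomial ring in four variables.
   Context: $SD_{16}=\langle a,b,c,d \mid a^2=c^2=d,\ b^2=d^2=e,\ a^{-1}ba=bc,\ a^{-1}ca=cd,\ b^{-1}cb=cd,\ d\text{ central}\rangle$, a group of order 16 with identity $e$. The defining relations of $S$ are homogeneous for the stated $SD_{16}$-degrees, so $S=\bigoplus_{g\in SD_{16}}S_g$ is $SD_{16}$-graded, and $S_e$ denotes the component of group degree $e$; equivalently, $S_e$ is the fixed subring under the corresponding action of the Hopf algebra $\mathbb{K}^{SD_{16}}=\operatorname{Hom}_{\mathbb{K}}(\mathbb{K}SD_{16},\mathbb{K})$. *)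

theory Defs
  imports
    "HOL-Library.Poly_Mapping"
    "HOL-Library.Numeral_Type"
    "HOL-Computational_Algebra.Computational_Algebra"
    "HOL-Algebra.Algebra"
    "HOL-Algebra.Algebraic_Closure_Type"
begin

section \<open>Groups given by generators and relations\<close>

text \<open>
  A word in the generators and their inverses is a list of signed letters: \<open>(g, True)\<close> stands
  for the generator \<open>g\<close> and \<open>(g, False)\<close> for its inverse.  A relation \<open>u = v\<close> is the
  pair \<open>(u, v)\<close>.
\<close>

type_synonym 'g gword = "('g \<times> bool) list"

inductive pres_eq :: "('g gword \<times> 'g gword) set \<Rightarrow> 'g gword \<Rightarrow> 'g gword \<Rightarrow> bool"
  for R where
  pres_refl: "pres_eq R u u"
| pres_sym: "pres_eq R u v \<Longrightarrow> pres_eq R v u"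
| pres_trans: "pres_eq R u v \<Longrightarrow> pres_eq R v w \<Longrightarrow> pres_eq R u w"
| pres_append: "pres_eq R u v \<Longrightarrow> pres_eq R u' v' \<Longrightarrow> pres_eq R (u @ u') (v @ v')"
| pres_cancel: "pres_eq R [(g, s), (g, \<not> s)] []"
| pres_rel: "(u, v) \<in> R \<Longrightarrow> pres_eq R u v"

definition pres_class :: "('g gword \<times> 'g gword) set \<Rightarrow> 'g gword \<Rightarrow> 'g gword set" where
  "pres_class R u = {v. pres_eq R u v}"

definition presented_group :: "('g gword \<times> 'g gword) set \<Rightarrow> 'g gword set monoid" where
  "presented_group R =
     \<lparr> partial_object.carrier = range (pres_class R),
       monoid.mult = (\<lambda>U V. \<Union>u\<in>U. \<Union>v\<in>V. pres_class R (u @ v)),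
       monoid.one = pres_class R [] \<rparr>"

lemma pres_class_eq_iff: "pres_class R u = pres_class R v \<longleftrightarrow> pres_eq R u v"
  unfolding pres_class_def by (blast intro: pres_refl pres_sym pres_trans)

lemma presented_group_mult:
  "pres_class R u \<otimes>\<^bsub>presented_group R\<^esub> pres_class R v = pres_class R (u @ v)"
proof -
  have "pres_class R (u' @ v') = pres_class R (u @ v)"
    if "u' \<in> pres_class R u" "v' \<in> pres_class R v" for u' v'
  proof -
    have "pres_eq R u u'" "pres_eq R v v'"
      using that by (simp_all add: pres_class_def)
    then show ?thesis
      by (metis pres_append pres_class_eq_iff)
  qed
  then have "(\<Union>u'\<in>pres_class R u. \<Union>v'\<in>pres_class R v. pres_class R (u' @ v'))
      = (\<Union>u'\<in>pres_class R u. \<Union>v'\<in>pres_class R v. pres_class R (u @ v))"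
    by (intro SUP_cong refl) simp
  moreover have "pres_class R u \<noteq> {}" "pres_class R v \<noteq> {}"
    unfolding pres_class_def using pres_refl by blast+
  ultimately show ?thesis
    by (simp add: presented_group_def)
qed

lemma presented_group_one: "\<one>\<^bsub>presented_group R\<^esub> = pres_class R []"
  by (simp add: presented_group_def)

lemma presented_group_carrier: "carrier (presented_group R) = range (pres_class R)"
  by (simp add: presented_group_def)

lemma pres_eq_inverse: "pres_eq R (rev (map (\<lambda>(g, s). (g, \<not> s)) u) @ u) []"
proof (induction u)
  case Nil
  then show ?case by (simp add: pres_refl)
next
  case (Cons l u)
  obtain g s where l: "l = (g, s)" by (cases l)
  let ?v = "rev (map (\<lambda>(g, s). (g, \<not> s)) u)"
  have "pres_eq R [(g, \<not> s), (g, s)] []"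
    using pres_cancel[of R g "\<not> s"] by simp
  then have "pres_eq R ([(g, \<not> s), (g, s)] @ u) ([] @ u)"
    by (rule pres_append) (rule pres_refl)
  then have "pres_eq R (?v @ [(g, \<not> s), (g, s)] @ u) (?v @ [] @ u)"
    by (rule pres_append[OF pres_refl])
  then show ?case
    using Cons.IH l by (auto intro: pres_trans)
qed

lemma group_presented_group: "group (presented_group R)"
proof (rule groupI)
  fix x assume "x \<in> carrier (presented_group R)"
  then obtain u where x: "x = pres_class R u"
    by (auto simp: presented_group_carrier)
  show "\<exists>y\<in>carrier (presented_group R). y \<otimes>\<^bsub>presented_group R\<^esub> x = \<one>\<^bsub>presented_group R\<^esub>"
    using pres_eq_inverse[of R u]
    by (auto simp: x presented_group_carrier presented_group_mult presented_group_one
        pres_class_eq_iff)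
qed (auto simp: presented_group_carrier presented_group_mult presented_group_one)


section \<open>The semidihedral group of order 16\<close>

datatype sd_letter = Ga | Gb | Gc | Gd

abbreviation pos :: "'g \<Rightarrow> 'g \<times> bool" where "pos g \<equiv> (g, True)"
abbreviation neg :: "'g \<Rightarrow> 'g \<times> bool" where "neg g \<equiv> (g, False)"

definition SD16_relations :: "(sd_letter gword \<times> sd_letter gword) set" where
  "SD16_relations =
     {([pos Ga, pos Ga], [pos Gd]), ([pos Gc, pos Gc], [pos Gd]),
      ([pos Gb, pos Gb], []), ([pos Gd, pos Gd], []),
      ([neg Ga, pos Gb, pos Ga], [pos Gb, pos Gc]),
      ([neg Ga, pos Gc, pos Ga], [pos Gc, pos Gd]),
      ([neg Gb, pos Gc, pos Gb], [pos Gc, pos Gd])}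
     \<union> {([pos Gd, pos g], [pos g, pos Gd]) | g. True}"

definition SD16 :: "sd_letter gword set monoid" where
  "SD16 = presented_group SD16_relations"

definition sd_gen :: "sd_letter \<Rightarrow> sd_letter gword set" where
  "sd_gen g = pres_class SD16_relations [pos g]"


section \<open>The algebra S\<close>

text \<open>
  Lists under concatenation are the free monoid, so that \<open>'x list \<Rightarrow>\<^sub>0 'k\<close> with its
  convolution product is the free associative algebra on \<open>'x\<close> over \<open>'k\<close>.
\<close>

instantiation list :: (type) monoid_add
begin

definition zero_list :: "'a list" where "zero_list = []"

definition plus_list :: "'a list \<Rightarrow> 'a list \<Rightarrow> 'a list" where "plus_list = (@)"

instance
  by standard (simp_all add: zero_list_def plus_list_def)

end

datatype S_letter = X1 | X2 | X3 | X4

type_synonym 'k free_alg = "S_letter list \<Rightarrow>\<^sub>0 'k"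

definition var :: "S_letter \<Rightarrow> 'k::field free_alg" where
  "var i = Poly_Mapping.single [i] 1"

definition S_relators :: "'k::field free_alg set" where
  "S_relators =
     {var X1 * var X2 - var X3 ^ 2,
      var X4 ^ 2 - var X2 * var X1,
      var X1 * var X3 - var X2 * var X4,
      var X4 * var X1 - var X3 * var X2,
      var X2 * var X3 - var X3 * var X1,
      var X4 * var X2 - var X1 * var X4}"

definition S_ideal :: "'k::field free_alg set" where
  "S_ideal = Idl\<^bsub>ring_of_type_algebra\<^esub> S_relators"

definition S_ring :: "'k::field free_alg set ring" where
  "S_ring = ring_of_type_algebra Quot S_ideal"

definition S_proj :: "'k::field free_alg \<Rightarrow> 'k free_alg set" where
  "S_proj p = S_ideal +>\<^bsub>ring_of_type_algebra\<^esub> p"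

definition S_var :: "S_letter \<Rightarrow> 'k::field free_alg set" where
  "S_var i = S_proj (var i)"

definition S_scalar :: "'k::field \<Rightarrow> 'k free_alg set" where
  "S_scalar k = S_proj (Poly_Mapping.single [] k)"

lemma ring_ring_of_type_algebra: "ring (ring_of_type_algebra :: 'a::ring_1 ring)"
proof -
  have "\<exists>y. y + x = 0 \<and> x + y = 0" for x :: 'a
    by (intro exI[of _ "- x"]) simp
  then show ?thesis
    unfolding ring_of_type_algebra_def
    by unfold_locales (auto simp: algebra_simps Units_def)
qed

lemma ring_S_ring: "ring (S_ring :: 'k::field free_alg set ring)"
proof -
  have "ring (ring_of_type_algebra :: 'k free_alg ring)"
    by (rule ring_ring_of_type_algebra)
  moreover have "S_relators \<subseteq> carrier (ring_of_type_algebra :: 'k free_alg ring)"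
    by (simp add: ring_of_type_algebra_def)
  ultimately show ?thesis
    unfolding S_ring_def S_ideal_def
    by (intro ideal.quotient_is_ring ring.genideal_ideal)
qed

text \<open>The unital \<open>'k\<close>-subalgebra generated by \<open>Y\<close>.\<close>

definition S_subalgebra_generated :: "'k::field free_alg set set \<Rightarrow> 'k free_alg set set" where
  "S_subalgebra_generated Y = generate_ring S_ring (range S_scalar \<union> Y)"


section \<open>The grading of S\<close>

fun S_letter_degree :: "S_letter \<Rightarrow> sd_letter gword set" where
  "S_letter_degree X1 = sd_gen Gb"
| "S_letter_degree X2 = sd_gen Gb \<otimes>\<^bsub>SD16\<^esub> sd_gen Gc"
| "S_letter_degree X3 = sd_gen Ga \<otimes>\<^bsub>SD16\<^esub> sd_gen Gb"
| "S_letter_degree X4 = sd_gen Ga \<otimes>\<^bsub>SD16\<^esub> sd_gen Gb \<otimes>\<^bsub>SD16\<^esub> sd_gen Gc \<otimes>\<^bsub>SD16\<^esub> sd_gen Gd"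

definition word_degree :: "S_letter list \<Rightarrow> sd_letter gword set" where
  "word_degree w = foldr (\<lambda>i g. S_letter_degree i \<otimes>\<^bsub>SD16\<^esub> g) w \<one>\<^bsub>SD16\<^esub>"

definition free_homogeneous :: "sd_letter gword set \<Rightarrow> 'k::field free_alg set" where
  "free_homogeneous g = {p. \<forall>w\<in>Poly_Mapping.keys p. word_degree w = g}"

definition S_component :: "sd_letter gword set \<Rightarrow> 'k::field free_alg set set" where
  "S_component g = S_proj ` free_homogeneous g"

lemma group_SD16: "group SD16"
  unfolding SD16_def by (rule group_presented_group)

lemma sd_gen_closed: "sd_gen g \<in> carrier SD16"
  by (simp add: sd_gen_def SD16_def presented_group_carrier)

lemma SD16_rewrites:
  defines "a \<equiv> sd_gen Ga" and "b \<equiv> sd_gen Gb" and "c \<equiv> sd_gen Gc" and "d \<equiv> sd_gen Gd"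
  shows "a \<otimes>\<^bsub>SD16\<^esub> a = d" "c \<otimes>\<^bsub>SD16\<^esub> c = d" "b \<otimes>\<^bsub>SD16\<^esub> b = \<one>\<^bsub>SD16\<^esub>" "d \<otimes>\<^bsub>SD16\<^esub> d = \<one>\<^bsub>SD16\<^esub>"
    and "b \<otimes>\<^bsub>SD16\<^esub> a = a \<otimes>\<^bsub>SD16\<^esub> (b \<otimes>\<^bsub>SD16\<^esub> c)"
    and "c \<otimes>\<^bsub>SD16\<^esub> a = a \<otimes>\<^bsub>SD16\<^esub> (c \<otimes>\<^bsub>SD16\<^esub> d)"
    and "c \<otimes>\<^bsub>SD16\<^esub> b = b \<otimes>\<^bsub>SD16\<^esub> (c \<otimes>\<^bsub>SD16\<^esub> d)"
    and "d \<otimes>\<^bsub>SD16\<^esub> a = a \<otimes>\<^bsub>SD16\<^esub> d" "d \<otimes>\<^bsub>SD16\<^esub> b = b \<otimes>\<^bsub>SD16\<^esub> d" "d \<otimes>\<^bsub>SD16\<^esub> c = c \<otimes>\<^bsub>SD16\<^esub> d"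
proof -
  have conj: "pres_eq SD16_relations (u @ [pos h]) (pos h # v)"
    if "(neg h # u @ [pos h], v) \<in> SD16_relations" for h u v
  proof -
    have step: "pres_eq SD16_relations ([pos h] @ (neg h # u @ [pos h])) ([pos h] @ v)"
      using that by (intro pres_append pres_refl pres_rel)
    have "pres_eq SD16_relations ([pos h, neg h] @ (u @ [pos h])) ([] @ (u @ [pos h]))"
      using pres_cancel[of SD16_relations h True] by (intro pres_append pres_refl) simp
    from pres_trans[OF pres_sym[OF this]] step show ?thesis
      by simp
  qed
  note defs = a_def b_def c_def d_def sd_gen_def SD16_def presented_group_mult
    presented_group_one pres_class_eq_iff
  show "a \<otimes>\<^bsub>SD16\<^esub> a = d" "c \<otimes>\<^bsub>SD16\<^esub> c = d" "b \<otimes>\<^bsub>SD16\<^esub> b = \<one>\<^bsub>SD16\<^esub>" "d \<otimes>\<^bsub>SD16\<^esub> d = \<one>\<^bsub>SD16\<^esub>"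
    "d \<otimes>\<^bsub>SD16\<^esub> a = a \<otimes>\<^bsub>SD16\<^esub> d" "d \<otimes>\<^bsub>SD16\<^esub> b = b \<otimes>\<^bsub>SD16\<^esub> d" "d \<otimes>\<^bsub>SD16\<^esub> c = c \<otimes>\<^bsub>SD16\<^esub> d"
    unfolding defs append.simps by (rule pres_rel, simp add: SD16_relations_def)+
  show "b \<otimes>\<^bsub>SD16\<^esub> a = a \<otimes>\<^bsub>SD16\<^esub> (b \<otimes>\<^bsub>SD16\<^esub> c)"
    using conj[of Ga "[pos Gb]" "[pos Gb, pos Gc]"] unfolding defs
    by (simp add: SD16_relations_def)
  show "c \<otimes>\<^bsub>SD16\<^esub> a = a \<otimes>\<^bsub>SD16\<^esub> (c \<otimes>\<^bsub>SD16\<^esub> d)"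
    using conj[of Ga "[pos Gc]" "[pos Gc, pos Gd]"] unfolding defs
    by (simp add: SD16_relations_def)
  show "c \<otimes>\<^bsub>SD16\<^esub> b = b \<otimes>\<^bsub>SD16\<^esub> (c \<otimes>\<^bsub>SD16\<^esub> d)"
    using conj[of Gb "[pos Gc]" "[pos Gc, pos Gd]"] unfolding defs
    by (simp add: SD16_relations_def)
qed

lemma S_relator_words_same_degree:
  "word_degree [X1, X2] = word_degree [X3, X3]"
  "word_degree [X4, X4] = word_degree [X2, X1]"
  "word_degree [X1, X3] = word_degree [X2, X4]"
  "word_degree [X4, X1] = word_degree [X3, X2]"
  "word_degree [X2, X3] = word_degree [X3, X1]"
  "word_degree [X4, X2] = word_degree [X1, X4]"
proof -
  interpret group SD16 by (rule group_SD16)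
  have ext: "x \<otimes>\<^bsub>SD16\<^esub> (y \<otimes>\<^bsub>SD16\<^esub> z) = v \<otimes>\<^bsub>SD16\<^esub> z"
    if "x \<otimes>\<^bsub>SD16\<^esub> y = v" "x \<in> carrier SD16" "y \<in> carrier SD16" "z \<in> carrier SD16" for x y z v
    using that m_assoc by metis
  note ext' = SD16_rewrites[THEN ext, OF sd_gen_closed sd_gen_closed]
  show "word_degree [X1, X2] = word_degree [X3, X3]"
    "word_degree [X4, X4] = word_degree [X2, X1]"
    "word_degree [X1, X3] = word_degree [X2, X4]"
    "word_degree [X4, X1] = word_degree [X3, X2]"
    "word_degree [X2, X3] = word_degree [X3, X1]"
    "word_degree [X4, X2] = word_degree [X1, X4]"
    by (simp_all add: word_degree_def m_assoc sd_gen_closed SD16_rewrites ext')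
qed

lemma S_relators_homogeneous:
  assumes "p \<in> (S_relators :: 'k::field free_alg set)"
  shows "\<exists>g. p \<in> free_homogeneous g"
proof -
  have hom: "var i * var j - var k * var l \<in> (free_homogeneous (word_degree [i, j]) :: 'k free_alg set)"
    if "word_degree [i, j] = word_degree [k, l]" for i j k l
  proof -
    have "Poly_Mapping.keys (var i * var j - var k * var l :: 'k free_alg) \<subseteq> {[i, j], [k, l]}"
      using keys_diff[of "Poly_Mapping.single [i, j] (1::'k)" "Poly_Mapping.single [k, l] 1"]
      by (auto simp: var_def mult_single plus_list_def)
    then show ?thesis
      using that by (auto simp: free_homogeneous_def)
  qed
  show ?thesis
    using assms S_relator_words_same_degree[THEN hom]
    unfolding S_relators_def power2_eq_square by (elim insertE emptyE) auto
qed

end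

theory Submission
  imports Defs
begin

text \<open>
  The six relations equate words, so \<open>S\<close> is the algebra of a monoid, and this monoid is of I-type:
  its elements correspond bijectively to vectors in \<open>\<nat>\<^sup>4\<close>, a letter acting on the left by a
  coordinate permutation followed by raising one coordinate.  Modulo 2 the same formulas define
  a regular action of \<open>SD16\<close> on the 16 parity vectors, so that a word has degree \<open>e\<close> iff its exponent
  vector is even.  The permutation part of such a word is trivial: the generators
  \<open>x\<^sub>1\<^sup>2, x\<^sub>2\<^sup>2, x\<^sub>3x\<^sub>4, x\<^sub>4x\<^sub>3\<close> add 2 to the four coordinates, and their monomials are a basis of \<open>S\<^sub>e\<close>.
\<close>

text \<open>Additive constructions on finitely supported functions are checked one term at a time.
  Freshness of \<open>a\<close> makes the support grow by exactly \<open>a\<close>, so conditions on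
  the support pass to the smaller function.\<close>

lemma poly_mapping_single_add_induct [case_names zero single_add]:
  assumes "P 0"
    and "\<And>a b p. a \<notin> Poly_Mapping.keys p \<Longrightarrow> b \<noteq> 0 \<Longrightarrow> P p \<Longrightarrow> P (Poly_Mapping.single a b + p)"
  shows "P (p :: 'a \<Rightarrow>\<^sub>0 'b::comm_monoid_add)"
proof (induction p rule: Poly_Mapping.update_induct)
  case const
  then show ?case by (rule assms(1))
next
  case (update p a b)
  have "Poly_Mapping.update a b p = Poly_Mapping.single a b + p"
    using update(1) by (intro poly_mapping_eqI)
      (auto simp: lookup_update lookup_add lookup_single in_keys_iff when_def)
  with update assms(2) show ?case by simp
qed

lemma keys_single_add:
  fixes p :: "'a \<Rightarrow>\<^sub>0 'b::comm_monoid_add"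
  assumes "a \<notin> Poly_Mapping.keys p" "b \<noteq> 0"
  shows "Poly_Mapping.keys (Poly_Mapping.single a b + p) = insert a (Poly_Mapping.keys p)"
  using assms by (auto simp: in_keys_iff lookup_add lookup_single when_def split: if_splits)

lemma ring_of_type_algebra_simps [simp]:
  "carrier ring_of_type_algebra = UNIV"
  "x \<oplus>\<^bsub>ring_of_type_algebra\<^esub> y = x + y"
  "x \<otimes>\<^bsub>ring_of_type_algebra\<^esub> y = x * y"
  "\<zero>\<^bsub>ring_of_type_algebra\<^esub> = 0"
  "\<one>\<^bsub>ring_of_type_algebra\<^esub> = 1"
  by (simp_all add: ring_of_type_algebra_def)


section \<open>The quotient map\<close>

lemma ideal_S_ideal: "ideal (S_ideal :: 'k::field free_alg set) ring_of_type_algebra"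
  unfolding S_ideal_def by (rule ring.genideal_ideal[OF ring_ring_of_type_algebra]) simp

lemma S_proj_hom: "ring_hom_ring ring_of_type_algebra (S_ring :: 'k::field free_alg set ring) S_proj"
  using ideal.rcos_ring_hom_ring[OF ideal_S_ideal] unfolding S_ring_def S_proj_def[abs_def] .

text \<open>Read from left to right, these equations turn identities in \<open>S_ring\<close> into
  arithmetic of representatives in the free algebra.\<close>

lemma S_ring_ops [simp]:
  "S_proj p \<oplus>\<^bsub>S_ring\<^esub> S_proj q = S_proj (p + q)"
  "S_proj p \<otimes>\<^bsub>S_ring\<^esub> S_proj q = S_proj (p * q)"
  "\<zero>\<^bsub>S_ring\<^esub> = S_proj (0 :: 'k free_alg)"
  "\<one>\<^bsub>S_ring\<^esub> = S_proj (1 :: 'k free_alg)"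
  "\<ominus>\<^bsub>S_ring\<^esub> S_proj p = S_proj (- p)"
  for p q :: "'k::field free_alg"
proof -
  interpret ring_hom_ring ring_of_type_algebra "S_ring :: 'k free_alg set ring" S_proj
    by (rule S_proj_hom)
  show "S_proj p \<oplus>\<^bsub>S_ring\<^esub> S_proj q = S_proj (p + q)"
    "S_proj p \<otimes>\<^bsub>S_ring\<^esub> S_proj q = S_proj (p * q)"
    "\<zero>\<^bsub>S_ring\<^esub> = S_proj (0 :: 'k free_alg)"
    "\<one>\<^bsub>S_ring\<^esub> = S_proj (1 :: 'k free_alg)"
    using hom_add[of p q] hom_mult[of p q] hom_zero hom_one by simp_all
  have "\<ominus>\<^bsub>ring_of_type_algebra\<^esub> p = - p"
    by (rule R.minus_equality) simp_all
  then show "\<ominus>\<^bsub>S_ring\<^esub> S_proj p = S_proj (- p)"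
    using hom_a_inv[of p] by simp
qed

lemma S_ring_carrier: "carrier (S_ring :: 'k::field free_alg set ring) = range S_proj"
  by (auto simp: S_ring_def S_proj_def FactRing_def A_RCOSETS_def RCOSETS_def a_r_coset_def)

lemma S_proj_eq_iff: "S_proj p = S_proj q \<longleftrightarrow> p - q \<in> S_ideal"
  for p q :: "'k::field free_alg"
proof -
  interpret ideal "S_ideal :: 'k free_alg set" ring_of_type_algebra
    by (rule ideal_S_ideal)
  have "p - q = p \<ominus>\<^bsub>ring_of_type_algebra\<^esub> q"
    using a_minus_def[of ring_of_type_algebra p q]
      abelian_group.minus_equality[OF abelian_group_axioms, of "- q" q] by simp
  then show ?thesis
    unfolding S_proj_def using quotient_eq_iff_same_a_r_cos[OF ideal_S_ideal, of p q]
    by simp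
qed

definition S_mon :: "S_letter list \<Rightarrow> 'k::field free_alg set" where
  "S_mon w = S_proj (Poly_Mapping.single w 1)"

lemma S_mon_append: "S_mon (u @ w) = S_mon u \<otimes>\<^bsub>S_ring\<^esub> (S_mon w :: 'k::field free_alg set)"
  by (simp add: S_mon_def mult_single plus_list_def)

lemma S_mon_append_cong:
  assumes "(S_mon u :: 'k::field free_alg set) = S_mon u'" "(S_mon w :: 'k free_alg set) = S_mon w'"
  shows "(S_mon (u @ w) :: 'k free_alg set) = S_mon (u' @ w')"
  by (simp add: S_mon_append assms)

lemma S_mon_Cons_cong:
  assumes "(S_mon w :: 'k::field free_alg set) = S_mon w'"
  shows "(S_mon (i # w) :: 'k free_alg set) = S_mon (i # w')"
  using S_mon_append_cong[of "[i]" "[i]", OF refl assms] by simp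

lemma S_mon_relations:
  "(S_mon [X1, X2] :: 'k::field free_alg set) = S_mon [X3, X3]"
  "(S_mon [X4, X4] :: 'k free_alg set) = S_mon [X2, X1]"
  "(S_mon [X1, X3] :: 'k free_alg set) = S_mon [X2, X4]"
  "(S_mon [X4, X1] :: 'k free_alg set) = S_mon [X3, X2]"
  "(S_mon [X2, X3] :: 'k free_alg set) = S_mon [X3, X1]"
  "(S_mon [X4, X2] :: 'k free_alg set) = S_mon [X1, X4]"
proof -
  have "(S_mon [i, j] :: 'k free_alg set) = S_mon [k, l]"
    if "var i * var j - var k * var l \<in> (S_relators :: 'k free_alg set)" for i j k l
  proof -
    have "var i * var j - var k * var l \<in> (S_ideal :: 'k free_alg set)"
      using ring.genideal_self[OF ring_ring_of_type_algebra, of S_relators] that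
      by (auto simp: S_ideal_def)
    then show ?thesis
      by (simp add: S_mon_def S_proj_eq_iff var_def mult_single plus_list_def)
  qed
  note rel = this
  show
    "(S_mon [X1, X2] :: 'k::field free_alg set) = S_mon [X3, X3]"
    "(S_mon [X4, X4] :: 'k free_alg set) = S_mon [X2, X1]"
    "(S_mon [X1, X3] :: 'k free_alg set) = S_mon [X2, X4]"
    "(S_mon [X4, X1] :: 'k free_alg set) = S_mon [X3, X2]"
    "(S_mon [X2, X3] :: 'k free_alg set) = S_mon [X3, X1]"
    "(S_mon [X4, X2] :: 'k free_alg set) = S_mon [X1, X4]"
    by (rule rel, simp add: S_relators_def power2_eq_square)+
qed


section \<open>Words and exponent vectors\<close>

type_synonym exponents = "nat \<times> nat \<times> nat \<times> nat"

text \<open>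
  The letter \<open>i\<close> acts by a permutation of the coordinates followed by raising the \<open>i\<close>-th
  coordinate.  The permutations \<open>(2 3)\<close>, \<open>(1 4)\<close>, \<open>(1 2 4 3)\<close>, \<open>(1 3 4 2)\<close> are read off from the
  relations: \<open>x\<^sub>i x\<^sub>j\<close> equals a word starting with the image of \<open>j\<close> under the permutation of \<open>i\<close>.
\<close>

fun act :: "S_letter \<Rightarrow> exponents \<Rightarrow> exponents" where
  "act X1 (p, q, r, s) = (Suc p, r, q, s)"
| "act X2 (p, q, r, s) = (s, Suc q, r, p)"
| "act X3 (p, q, r, s) = (r, p, Suc s, q)"
| "act X4 (p, q, r, s) = (q, s, p, Suc r)"

text \<open>The leftmost letter acts last, so concatenation of words becomes composition of
  maps.\<close>

definition act_word :: "S_letter list \<Rightarrow> exponents \<Rightarrow> exponents" where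
  "act_word w = foldr act w"

abbreviation exponents_of :: "S_letter list \<Rightarrow> exponents" where
  "exponents_of w \<equiv> act_word w (0, 0, 0, 0)"

lemma act_word_simps [simp]:
  "act_word [] m = m"
  "act_word (i # w) m = act i (act_word w m)"
  "act_word (u @ w) m = act_word u (act_word w m)"
  by (simp_all add: act_word_def)

lemma act_nonzero: "act i m \<noteq> (0, 0, 0, 0)"
  by (cases m; cases i) auto

lemma act_inject: "act i m = act i n \<Longrightarrow> m = n"
  by (cases m; cases n; cases i) auto

text \<open>Each unordered pair of distinct letters occurs exactly once as the pair of first letters
  of a relation; \<open>k\<close> and \<open>l\<close> are the second letters of the relation
  belonging to \<open>j\<close> and \<open>i\<close>.\<close>

lemma act_eq_act:
  assumes "act j m = act i n" "i \<noteq> j"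
  shows "\<exists>k l s. m = act k s \<and> n = act l s \<and> (S_mon [j, k] :: 'k::field free_alg set) = S_mon [i, l]"
proof -
  obtain m1 m2 m3 m4 n1 n2 n3 n4 where mn: "m = (m1, m2, m3, m4)" "n = (n1, n2, n3, n4)"
    by (metis prod_cases4)
  have wit: ?thesis if "m = act k s" "n = act l s" "(S_mon [j, k] :: 'k free_alg set) = S_mon [i, l]"
    for k l s using that by blast
  note rels = S_mon_relations[where ?'k = 'k]
  show ?thesis
  proof (cases j; cases i)
    \<comment> \<open>In every case \<open>s\<close> is \<open>m\<close> with the action of
      \<open>k\<close> undone. Comparing the coordinates number \<open>i\<close> in the hypothesis
      shows that the entry lowered by 1 is positive, so the truncated subtraction is exact.\<close>
    assume "j = X1" "i = X2" with assms mn show ?thesis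
      by (intro wit[of X3 "(m2, m4, m1, m3 - 1)" X4]) (auto simp: rels)
  next
    assume "j = X1" "i = X3" with assms mn show ?thesis
      by (intro wit[of X2 "(m4, m2 - 1, m3, m1)" X3]) (auto simp: rels)
  next
    assume "j = X1" "i = X4" with assms mn show ?thesis
      by (intro wit[of X4 "(m3, m1, m4 - 1, m2)" X2]) (auto simp: rels)
  next
    assume "j = X2" "i = X1" with assms mn show ?thesis
      by (intro wit[of X4 "(m3, m1, m4 - 1, m2)" X3]) (auto simp: rels)
  next
    assume "j = X2" "i = X3" with assms mn show ?thesis
      by (intro wit[of X3 "(m2, m4, m1, m3 - 1)" X1]) (auto simp: rels)
  next
    assume "j = X2" "i = X4" with assms mn show ?thesis
      by (intro wit[of X1 "(m1 - 1, m3, m2, m4)" X4]) (auto simp: rels)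
  next
    assume "j = X3" "i = X1" with assms mn show ?thesis
      by (intro wit[of X3 "(m2, m4, m1, m3 - 1)" X2]) (auto simp: rels)
  next
    assume "j = X3" "i = X2" with assms mn show ?thesis
      by (intro wit[of X1 "(m1 - 1, m3, m2, m4)" X3]) (auto simp: rels)
  next
    assume "j = X3" "i = X4" with assms mn show ?thesis
      by (intro wit[of X2 "(m4, m2 - 1, m3, m1)" X1]) (auto simp: rels)
  next
    assume "j = X4" "i = X1" with assms mn show ?thesis
      by (intro wit[of X2 "(m4, m2 - 1, m3, m1)" X4]) (auto simp: rels)
  next
    assume "j = X4" "i = X2" with assms mn show ?thesis
      by (intro wit[of X4 "(m3, m1, m4 - 1, m2)" X1]) (auto simp: rels)
  next
    assume "j = X4" "i = X3" with assms mn show ?thesis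
      by (intro wit[of X1 "(m1 - 1, m3, m2, m4)" X2]) (auto simp: rels)
  qed (use assms(2) in auto)
qed

text \<open>If \<open>w\<close> already begins with \<open>i\<close>, injectivity of
  \<open>act i\<close> suffices. Otherwise the induction hypothesis brings to the front of the tail
  the letter \<open>k\<close> for which a relation turns \<open>[j, k]\<close> into
  \<open>[i, l]\<close>.\<close>

lemma S_mon_peel:
  assumes "exponents_of w = act i n"
  shows "\<exists>u. (S_mon w :: 'k::field free_alg set) = S_mon (i # u) \<and> exponents_of u = n"
  using assms
proof (induction w arbitrary: i n)
  case Nil
  then show ?case
    using act_nonzero[of i n] by simp
next
  case (Cons j w)
  show ?case
  proof (cases "i = j")
    case True
    then show ?thesis
      using act_inject[of j "exponents_of w" n] Cons.prems by auto
  next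
    case False
    from Cons.prems have "act j (exponents_of w) = act i n" by simp
    from act_eq_act[OF this False, where ?'k = 'k] obtain k l s
      where kls: "exponents_of w = act k s" "n = act l s"
        "(S_mon [j, k] :: 'k free_alg set) = S_mon [i, l]"
      by blast
    from Cons.IH[OF kls(1)] obtain u
      where u: "(S_mon w :: 'k free_alg set) = S_mon (k # u)" "exponents_of u = s"
      by blast
    have "(S_mon (j # w) :: 'k free_alg set) = S_mon (j # k # u)"
      by (rule S_mon_Cons_cong[OF u(1)])
    also have "\<dots> = S_mon (i # l # u)"
      using S_mon_append_cong[OF kls(3) refl[of "S_mon u"]] by simp
    finally show ?thesis
      using u(2) kls(2) by (intro exI[of _ "l # u"]) simp
  qed
qed

text \<open>Peeling the first letter of one word off the other reduces to shorter words, and only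
  the empty word has exponent vector zero. Hence \<open>S\<close> has at most one monomial per
  exponent vector.\<close>

lemma S_mon_eqI:
  assumes "exponents_of w = exponents_of w'"
  shows "(S_mon w :: 'k::field free_alg set) = S_mon w'"
  using assms
proof (induction w arbitrary: w')
  case Nil
  then show ?case
    using act_nonzero by (cases w') (metis act_word_simps(1,2))+
next
  case (Cons i w)
  then have "exponents_of w' = act i (exponents_of w)" by simp
  from S_mon_peel[OF this, where ?'k = 'k] obtain u
    where u: "(S_mon w' :: 'k free_alg set) = S_mon (i # u)" "exponents_of u = exponents_of w"
    by blast
  then show ?case
    using S_mon_Cons_cong[OF Cons.IH[OF u(2)[symmetric]]] by simp
qed


section \<open>The group degree of a word\<close>

text \<open>
  \<open>SD16\<close> acts regularly on the exponent vectors modulo 2, where the group degree of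
  \<open>x\<^sub>i\<close> acts as \<open>act i\<close> does.
\<close>

fun gact :: "sd_letter \<times> bool \<Rightarrow> bool \<times> bool \<times> bool \<times> bool \<Rightarrow> bool \<times> bool \<times> bool \<times> bool" where
  "gact (Ga, True) (p, q, r, s) = (q, \<not> p, \<not> s, r)"
| "gact (Ga, False) (p, q, r, s) = (\<not> q, p, s, \<not> r)"
| "gact (Gb, _) (p, q, r, s) = (\<not> p, r, q, s)"
| "gact (Gc, True) (p, q, r, s) = (\<not> s, r, \<not> q, p)"
| "gact (Gc, False) (p, q, r, s) = (s, \<not> r, q, \<not> p)"
| "gact (Gd, _) (p, q, r, s) = (\<not> p, \<not> q, \<not> r, \<not> s)"

text \<open>Cancellation and every defining relation hold as identities between maps of parity
  vectors, so the action of a word depends only on the group element it represents.\<close>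

lemma gact_pres_eq:
  assumes "pres_eq SD16_relations u v"
  shows "foldr gact u = foldr gact v"
  using assms
proof induction
  case (pres_cancel g s)
  show ?case by (cases g; cases s) (auto simp: fun_eq_iff)
next
  case (pres_rel u v)
  \<comment> \<open>Centrality of \<open>Gd\<close> is a family of relations, one per letter, hence
    the separate case distinction.\<close>
  have "foldr gact [pos Gd, pos g] = foldr gact [pos g, pos Gd]" for g
    by (cases g) (auto simp: fun_eq_iff)
  with pres_rel show ?case
    unfolding SD16_relations_def by (auto simp: fun_eq_iff)
qed auto

fun degree_word :: "S_letter \<Rightarrow> sd_letter gword" where
  "degree_word X1 = [pos Gb]"
| "degree_word X2 = [pos Gb, pos Gc]"
| "degree_word X3 = [pos Ga, pos Gb]"
| "degree_word X4 = [pos Ga, pos Gb, pos Gc, pos Gd]"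

lemma word_degree_eq_class:
  "word_degree w = pres_class SD16_relations (concat (map degree_word w))"
proof (induction w)
  case Nil
  show ?case by (simp add: word_degree_def SD16_def presented_group_one)
next
  case (Cons i w)
  have "S_letter_degree i = pres_class SD16_relations (degree_word i)"
    by (cases i) (simp_all add: SD16_def sd_gen_def presented_group_mult)
  with Cons show ?case
    by (simp add: word_degree_def SD16_def presented_group_mult)
qed

fun parity :: "exponents \<Rightarrow> bool \<times> bool \<times> bool \<times> bool" where
  "parity (p, q, r, s) = (odd p, odd q, odd r, odd s)"

text \<open>Raising a coordinate flips its parity, and the degree of each letter permutes the
  coordinates as the letter itself does.\<close>

lemma gact_degree_words:
  "foldr gact (concat (map degree_word w)) (parity m) = parity (act_word w m)"
proof (induction w)
  case (Cons i w)
  obtain p q r s where "act_word w m = (p, q, r, s)" by (metis prod_cases4)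
  with Cons show ?case by (cases i) simp_all
qed simp

text \<open>The group identity fixes the zero parity vector, whereas the degree of \<open>w\<close>
  sends it to the parity of \<open>exponents_of w\<close>.\<close>

lemma even_exponents_if_degree_one:
  assumes "word_degree w = \<one>\<^bsub>SD16\<^esub>"
  shows "parity (exponents_of w) = (False, False, False, False)"
proof -
  have "pres_eq SD16_relations (concat (map degree_word w)) []"
    using assms by (simp add: word_degree_eq_class SD16_def presented_group_one pres_class_eq_iff)
  from gact_pres_eq[OF this] show ?thesis
    using gact_degree_words[of w "(0, 0, 0, 0)"] by simp
qed

lemma word_degree_Nil: "word_degree [] = \<one>\<^bsub>SD16\<^esub>"
  by (simp add: word_degree_def)

lemma word_degree_append: "word_degree (u @ w) = word_degree u \<otimes>\<^bsub>SD16\<^esub> word_degree w"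
  by (simp add: word_degree_eq_class SD16_def presented_group_mult)

lemma word_degree_basic:
  "word_degree [X1, X1] = \<one>\<^bsub>SD16\<^esub>" "word_degree [X2, X2] = \<one>\<^bsub>SD16\<^esub>"
  "word_degree [X3, X4] = \<one>\<^bsub>SD16\<^esub>" "word_degree [X4, X3] = \<one>\<^bsub>SD16\<^esub>"
proof -
  interpret group SD16 by (rule group_SD16)
  \<comment> \<open>Each rule for a product of two letters is extended to the front of a longer
    right-nested product, so that rewriting can sort the letters into the order a, b, c, d.\<close>
  have ext: "x \<otimes>\<^bsub>SD16\<^esub> (y \<otimes>\<^bsub>SD16\<^esub> z) = v \<otimes>\<^bsub>SD16\<^esub> z"
    if "x \<otimes>\<^bsub>SD16\<^esub> y = v" "x \<in> carrier SD16" "y \<in> carrier SD16" "z \<in> carrier SD16" for x y z v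
    using that m_assoc by metis
  note ext' = SD16_rewrites[THEN ext, OF sd_gen_closed sd_gen_closed]
  show "word_degree [X1, X1] = \<one>\<^bsub>SD16\<^esub>" "word_degree [X2, X2] = \<one>\<^bsub>SD16\<^esub>"
    "word_degree [X3, X4] = \<one>\<^bsub>SD16\<^esub>" "word_degree [X4, X3] = \<one>\<^bsub>SD16\<^esub>"
    by (simp_all add: word_degree_def m_assoc sd_gen_closed SD16_rewrites ext')
qed


section \<open>The representation of the free algebra on functions of exponent vectors\<close>

text \<open>Words act on functions by composition with \<open>act_word\<close>, extended linearly;
  this is dual to the action on the vector space spanned by the exponent vectors.\<close>

definition ev :: "'k::field free_alg \<Rightarrow> (exponents \<Rightarrow> 'k) \<Rightarrow> exponents \<Rightarrow> 'k" where
  "ev p f m = (\<Sum>w\<in>Poly_Mapping.keys p. Poly_Mapping.lookup p w * f (act_word w m))"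

lemma ev_single: "ev (Poly_Mapping.single w k) f = (\<lambda>m. k * f (act_word w m))"
  by (cases "k = 0") (auto simp: ev_def)

lemma ev_zero: "ev 0 f = (\<lambda>_. 0)"
  by (simp add: ev_def fun_eq_iff)

lemma ev_add: "ev (p + q) f = (\<lambda>m. ev p f m + ev q f m)"
  unfolding ev_def by (intro ext setsum_keys_plus_distrib) (simp_all add: algebra_simps)

lemma ev_zero_fun: "ev p (\<lambda>_. 0) = (\<lambda>_. 0)"
  by (simp add: ev_def fun_eq_iff)

text \<open>Composing functions with maps reverses the order, so the functions form a right module.
  Additivity in both factors reduces the claim to single words.\<close>

lemma ev_mult: "ev (p * q) f = ev q (ev p f)"
proof (induction p rule: poly_mapping_single_add_induct)
  case (single_add w k p)
  have "ev (Poly_Mapping.single w k * q) f = ev q (\<lambda>m. k * f (act_word w m))"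
  proof (induction q rule: poly_mapping_single_add_induct)
    case (single_add u l q)
    then show ?case
      by (simp add: distrib_left mult_single ev_add ev_single plus_list_def fun_eq_iff)
  qed (simp add: ev_zero)
  moreover have "ev q (\<lambda>m. g m + h m) = (\<lambda>m. ev q g m + ev q h m)" for g h :: "exponents \<Rightarrow> 'a"
    by (simp add: ev_def fun_eq_iff distrib_left sum.distrib)
  ultimately show ?case
    by (simp add: distrib_right ev_add ev_single single_add.IH)
qed (simp add: ev_zero ev_zero_fun)

lemma ev_uminus: "ev (- p) f = (\<lambda>m. - ev p f m)"
  using ev_add[of p "- p" f] by (auto simp: ev_zero fun_eq_iff eq_neg_iff_add_eq_0 add.commute)

text \<open>The elements acting as zero form a two-sided ideal, which contains the relators because
  both words of a relation act by the same map. Thus \<open>ev\<close> descends to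
  \<open>S\<close>.\<close>

lemma ev_S_ideal:
  assumes "p \<in> S_ideal"
  shows "ev p f m = (0 :: 'k::field)"
proof -
  let ?R = "ring_of_type_algebra :: 'k free_alg ring"
  define A where "A = {p :: 'k free_alg. \<forall>f. ev p f = (\<lambda>_. 0)}"
  have "ideal A ?R"
  proof (rule idealI[OF ring_ring_of_type_algebra])
    interpret ring ?R by (rule ring_ring_of_type_algebra)
    have inv: "inv\<^bsub>add_monoid ?R\<^esub> x = - x" for x
      using minus_equality[of "- x" x] by (simp add: a_inv_def)
    show "subgroup A (add_monoid ?R)"
    proof
      show "inv\<^bsub>add_monoid ?R\<^esub> p \<in> A" if "p \<in> A" for p
        using that unfolding inv A_def by (simp add: ev_uminus)
    qed (auto simp: A_def ev_add ev_zero)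
  qed (auto simp: A_def ev_mult ev_zero_fun)
  moreover have "ev (var i * var j - var k * var l) f = (\<lambda>_. 0 :: 'k)"
    if "\<And>p q r s. act i (act j (p, q, r, s)) = act k (act l (p, q, r, s))" for i j k l f
  proof -
    have "act i (act j m) = act k (act l m)" for m
      using that by (cases m) auto
    then show ?thesis
      using ev_add[of "var i * var j" "- (var k * var l)" f]
      by (simp add: ev_uminus ev_mult var_def ev_single)
  qed
  then have "S_relators \<subseteq> A"
    by (auto simp: S_relators_def A_def power2_eq_square)
  ultimately have "S_ideal \<subseteq> A"
    unfolding S_ideal_def by (rule ring.genideal_minimal[OF ring_ring_of_type_algebra])
  with assms show ?thesis by (auto simp: A_def)
qed


section \<open>Polynomials in the four generators\<close>

fun even_word :: "exponents \<Rightarrow> S_letter list" where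
  "even_word (p, q, r, s) =
     concat (replicate p [X1, X1]) @ concat (replicate q [X2, X2])
     @ concat (replicate r [X3, X4]) @ concat (replicate s [X4, X3])"

text \<open>Within each of the four pairs the coordinate permutations cancel and both increments
  land on the same coordinate, so every pair acts as a translation.\<close>

lemma act_word_even_word:
  "act_word (even_word (p, q, r, s)) (p', q', r', s')
    = (2 * p + p', 2 * q + q', 2 * r + r', 2 * s + s')"
proof -
  have 1: "act_word (concat (replicate n [X1, X1])) (p, q, r, s) = (p + 2 * n, q, r, s)" for n p q r s
    by (induction n) auto
  have 2: "act_word (concat (replicate n [X2, X2])) (p, q, r, s) = (p, q + 2 * n, r, s)" for n p q r s
    by (induction n) auto
  have 3: "act_word (concat (replicate n [X3, X4])) (p, q, r, s) = (p, q, r + 2 * n, s)" for n p q r s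
    by (induction n) auto
  have 4: "act_word (concat (replicate n [X4, X3])) (p, q, r, s) = (p, q, r, s + 2 * n)" for n p q r s
    by (induction n) auto
  show ?thesis by (simp add: 1 2 3 4)
qed

lemma word_degree_even_word: "word_degree (even_word m) = \<one>\<^bsub>SD16\<^esub>"
proof -
  interpret group SD16 by (rule group_SD16)
  have "word_degree (concat (replicate n u)) = \<one>\<^bsub>SD16\<^esub>" if "word_degree u = \<one>\<^bsub>SD16\<^esub>" for n u
    by (induction n) (simp_all add: word_degree_Nil word_degree_append that)
  then show ?thesis
    by (cases m) (simp add: word_degree_append word_degree_basic)
qed

section \<open>Commutative monomials as exponent vectors\<close>

definition coords :: "(4 \<Rightarrow>\<^sub>0 nat) \<Rightarrow> exponents" where
  "coords m = (Poly_Mapping.lookup m 1, Poly_Mapping.lookup m 2,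
     Poly_Mapping.lookup m 3, Poly_Mapping.lookup m 4)"

lemma exhaust_numeral_4: "i = 1 \<or> i = 2 \<or> i = 3 \<or> i = (4 :: 4)"
proof (cases i)
  case (of_int z)
  \<comment> \<open>In the type \<open>4\<close> the numeral 4 equals 0, so the representative
    \<open>z = 0\<close> yields the last variable.\<close>
  then have "z = 0 \<or> z = 1 \<or> z = 2 \<or> z = 3" by auto
  with of_int show ?thesis by auto
qed

lemma inj_coords: "inj coords"
proof (rule injI, rule poly_mapping_eqI)
  fix m n :: "4 \<Rightarrow>\<^sub>0 nat" and i
  assume "coords m = coords n"
  then show "Poly_Mapping.lookup m i = Poly_Mapping.lookup n i"
    using exhaust_numeral_4[of i] by (elim disjE) (simp_all add: coords_def)
qed

lemma surj_coords: "\<exists>m. coords m = n"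
proof -
  obtain p q r s where n: "n = (p, q, r, s)" by (metis prod_cases4)
  have "coords (Poly_Mapping.single 1 p + Poly_Mapping.single 2 q
      + Poly_Mapping.single 3 r + Poly_Mapping.single 4 s) = n"
    by (simp add: n coords_def lookup_add lookup_single)
  then show ?thesis by blast
qed

text \<open>A linear lift only: in the free algebra the blocks of \<open>even_word\<close> do not
  commute, so products are respected only after passing to \<open>S\<close>.\<close>

definition poly_lift :: "((4 \<Rightarrow>\<^sub>0 nat) \<Rightarrow>\<^sub>0 'k::field) \<Rightarrow> 'k free_alg" where
  "poly_lift q = (\<Sum>m\<in>Poly_Mapping.keys q.
     Poly_Mapping.single (even_word (coords m)) (Poly_Mapping.lookup q m))"

lemma poly_lift_zero: "poly_lift 0 = 0"
  by (simp add: poly_lift_def)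

lemma poly_lift_single:
  "poly_lift (Poly_Mapping.single m k) = Poly_Mapping.single (even_word (coords m)) k"
  by (cases "k = 0") (simp_all add: poly_lift_def)

lemma poly_lift_add: "poly_lift (p + q) = poly_lift p + poly_lift q"
  unfolding poly_lift_def by (intro setsum_keys_plus_distrib) (simp_all add: single_add)

lemma poly_lift_one: "poly_lift 1 = 1"
proof -
  have "coords 0 = (0, 0, 0, 0)" by (simp add: coords_def)
  then show ?thesis
    using poly_lift_single[of 0 1] by (simp add: zero_list_def flip: single_one)
qed

section \<open>The homomorphism from the polynomial ring to S\<close>

definition poly_map :: "((4 \<Rightarrow>\<^sub>0 nat) \<Rightarrow>\<^sub>0 'k::field) \<Rightarrow> 'k free_alg set" where
  "poly_map q = S_proj (poly_lift q)"

lemma poly_map_zero: "poly_map 0 = \<zero>\<^bsub>S_ring\<^esub>"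
  by (simp add: poly_map_def poly_lift_zero)

lemma poly_map_one: "poly_map 1 = \<one>\<^bsub>S_ring\<^esub>"
  by (simp add: poly_map_def poly_lift_one)

lemma poly_map_add: "poly_map (p + q) = poly_map p \<oplus>\<^bsub>S_ring\<^esub> poly_map q"
  by (simp add: poly_map_def poly_lift_add)

lemma poly_map_uminus: "poly_map (- q) = \<ominus>\<^bsub>S_ring\<^esub> poly_map q"
proof -
  have "poly_lift q + poly_lift (- q) = 0"
    using poly_lift_add[of q "- q"] by (simp add: poly_lift_zero)
  then have "poly_lift (- q) = - poly_lift q"
    by (simp add: eq_neg_iff_add_eq_0 add.commute)
  then show ?thesis by (simp add: poly_map_def)
qed

lemma S_proj_single:
  "S_proj (Poly_Mapping.single w k) = S_scalar k \<otimes>\<^bsub>S_ring\<^esub> S_mon w"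
  by (simp add: S_scalar_def S_mon_def mult_single plus_list_def)

lemma poly_map_single:
  "poly_map (Poly_Mapping.single m k) = S_scalar k \<otimes>\<^bsub>S_ring\<^esub> S_mon (even_word (coords m))"
  by (simp add: poly_map_def poly_lift_single S_proj_single)

text \<open>Even words act by translations, whose composition adds the vectors, so both words have
  the same exponents. This is what makes the four generators commute in \<open>S\<close>.\<close>

lemma S_mon_even_word_add:
  "(S_mon (even_word (coords (m + n))) :: 'k::field free_alg set)
    = S_mon (even_word (coords m) @ even_word (coords n))"
proof -
  have eq: "act_word (even_word (p, q, r, s)) (p', q', r', s')
      = (2 * p + p', 2 * q + q', 2 * r + r', 2 * s + s')" for p q r s p' q' r' s'
    by (rule act_word_even_word)
  show ?thesis
    by (rule S_mon_eqI) (simp only: coords_def lookup_add eq act_word_simps, simp)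
qed

lemma poly_map_mult:
  "poly_map (p * q) = poly_map p \<otimes>\<^bsub>S_ring\<^esub> (poly_map q :: 'k::field free_alg set)"
proof -
  interpret ring "S_ring :: 'k free_alg set ring" by (rule ring_S_ring)
  have closed: "poly_map p \<in> carrier S_ring" for p :: "(4 \<Rightarrow>\<^sub>0 nat) \<Rightarrow>\<^sub>0 'k"
    by (simp add: poly_map_def S_ring_carrier)
  show ?thesis
  proof (induction p rule: poly_mapping_single_add_induct)
    case (single_add m k p)
    \<comment> \<open>Additivity in each factor leaves only products of two single terms, where the
      previous lemma on even words applies.\<close>
    have "poly_map (Poly_Mapping.single m k * q)
        = poly_map (Poly_Mapping.single m k) \<otimes>\<^bsub>S_ring\<^esub> (poly_map q :: 'k free_alg set)"
    proof (induction q rule: poly_mapping_single_add_induct)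
      case (single_add n l q)
      have "poly_map (Poly_Mapping.single m k * Poly_Mapping.single n l)
          = poly_map (Poly_Mapping.single m k) \<otimes>\<^bsub>S_ring\<^esub> poly_map (Poly_Mapping.single n l)"
        unfolding mult_single poly_map_single S_mon_even_word_add
        by (simp add: S_scalar_def S_mon_def mult_single plus_list_def)
      with single_add.IH show ?case
        by (simp add: distrib_left poly_map_add r_distr closed)
    qed (simp add: poly_map_def poly_lift_zero)
    with single_add.IH show ?case
      by (simp add: distrib_right poly_map_add l_distr closed)
  qed (simp add: poly_map_def poly_lift_zero)
qed

lemma poly_map_scalar: "poly_map (Poly_Mapping.single 0 k) = S_scalar k"
proof -
  have "coords 0 = (0, 0, 0, 0)" by (simp add: coords_def)
  then show ?thesis by (simp add: poly_map_def poly_lift_single S_scalar_def)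
qed

text \<open>
  Applied to the indicator function of \<open>2 * coords m\<close> and evaluated at the zero vector, \<open>ev\<close>
  recovers the coefficient at \<open>m\<close>.
\<close>

lemma inj_poly_map: "inj (poly_map :: _ \<Rightarrow> 'k::field free_alg set)"
proof (rule injI, rule poly_mapping_eqI)
  fix p q :: "(4 \<Rightarrow>\<^sub>0 nat) \<Rightarrow>\<^sub>0 'k" and m
  define \<delta> :: "exponents \<Rightarrow> 'k"
    where "\<delta> t = (if t = exponents_of (even_word (coords m)) then 1 else 0)" for t
  have "exponents_of (even_word (coords n)) = exponents_of (even_word (coords m)) \<longleftrightarrow> n = m" for n
  proof
    assume "exponents_of (even_word (coords n)) = exponents_of (even_word (coords m))"
    then have "coords n = coords m"
      by (cases "coords n"; cases "coords m") (simp add: act_word_even_word del: even_word.simps)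
    then show "n = m" using inj_coords by (auto dest: injD)
  qed simp
  then have coeff: "ev (poly_lift p) \<delta> (0, 0, 0, 0) = Poly_Mapping.lookup p m" for p
  proof (induction p rule: poly_mapping_single_add_induct)
    case (single_add n k p)
    then show ?case
      by (auto simp: poly_lift_add poly_lift_single ev_add ev_single lookup_add lookup_single \<delta>_def)
  qed (simp add: poly_lift_zero ev_zero)
  assume "poly_map p = poly_map q"
  then have "poly_lift p - poly_lift q \<in> S_ideal"
    by (simp add: poly_map_def S_proj_eq_iff)
  then have "ev (poly_lift p + - poly_lift q) \<delta> (0, 0, 0, 0) = 0"
    using ev_S_ideal by simp
  then show "Poly_Mapping.lookup p m = Poly_Mapping.lookup q m"
    unfolding ev_add ev_uminus coeff by simp
qed

text \<open>Even words have degree e. Conversely, a word of degree e has even exponents and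
  therefore equals an even word in \<open>S\<close>; linear combinations follow term by
  term.\<close>

lemma range_poly_map: "range poly_map = (S_component \<one>\<^bsub>SD16\<^esub> :: 'k::field free_alg set set)"
proof
  show "range poly_map \<subseteq> (S_component \<one>\<^bsub>SD16\<^esub> :: 'k free_alg set set)"
  proof -
    have "word_degree w = \<one>\<^bsub>SD16\<^esub>" if "w \<in> Poly_Mapping.keys (poly_lift q :: 'k free_alg)" for w q
      using that
    proof (induction q rule: poly_mapping_single_add_induct)
      case (single_add m k q)
      then show ?case
        using keys_add[of "poly_lift (Poly_Mapping.single m k)" "poly_lift q"]
        by (auto simp: poly_lift_add poly_lift_single word_degree_even_word split: if_splits)
    qed (simp add: poly_lift_zero)
    then show ?thesis
      by (auto simp: S_component_def free_homogeneous_def poly_map_def)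
  qed
  show "(S_component \<one>\<^bsub>SD16\<^esub> :: 'k free_alg set set) \<subseteq> range poly_map"
  proof -
    have "S_proj p \<in> range poly_map"
      if "\<forall>w\<in>Poly_Mapping.keys p. word_degree w = \<one>\<^bsub>SD16\<^esub>" for p :: "'k free_alg"
      using that
    proof (induction p rule: poly_mapping_single_add_induct)
      case zero
      show ?case using poly_map_zero[where ?'a = 'k] by (simp add: image_iff) metis
    next
      case (single_add w k p)
      have "word_degree w = \<one>\<^bsub>SD16\<^esub>" "S_proj p \<in> range poly_map"
        using single_add by (simp_all add: keys_single_add)
      then obtain q where q: "S_proj p = poly_map q" by blast
      obtain a b c d where "exponents_of w = (a, b, c, d)" by (metis prod_cases4)
      \<comment> \<open>All four exponents are even, so halving them is exact and gives the vector
        of the required even word.\<close>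
      with even_exponents_if_degree_one[OF \<open>word_degree w = \<one>\<^bsub>SD16\<^esub>\<close>]
      have "exponents_of w = exponents_of (even_word (a div 2, b div 2, c div 2, d div 2))"
        by (simp add: act_word_even_word del: even_word.simps)
      then obtain m where "exponents_of w = exponents_of (even_word (coords m))"
        using surj_coords by metis
      then have "S_proj (Poly_Mapping.single w k) = poly_map (Poly_Mapping.single m k)"
        unfolding S_proj_single poly_map_single by (metis S_mon_eqI)
      then have "S_proj (Poly_Mapping.single w k + p) = poly_map (Poly_Mapping.single m k + q)"
        using q by (simp add: poly_map_add flip: S_ring_ops(1))
      then show ?case by blast
    qed
    then show ?thesis
      by (auto simp: S_component_def free_homogeneous_def)
  qed
qed

text \<open>Even words are products of the generators; conversely, the image of a ring homomorphism
  is closed under the ring operations, and it contains the scalars and the generators.\<close>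

lemma range_poly_map_eq_generated:
  "range poly_map = (S_subalgebra_generated
    {S_mon [X1, X1], S_mon [X2, X2], S_mon [X3, X4], S_mon [X4, X3]} :: 'k::field free_alg set set)"
  (is "_ = S_subalgebra_generated ?Y")
proof
  let ?G = "S_subalgebra_generated ?Y"
  interpret ring "S_ring :: 'k free_alg set ring" by (rule ring_S_ring)
  note G_def = S_subalgebra_generated_def
  have Y: "y \<in> ?G" if "y \<in> ?Y" for y
    using that unfolding G_def by (intro generate_ring.incl) blast
  have one: "S_mon [] \<in> ?G"
    using generate_ring.one[of S_ring "range S_scalar \<union> ?Y"]
    by (simp add: G_def S_mon_def zero_list_def flip: single_one)
  have append: "S_mon (u @ w) \<in> ?G" if "S_mon u \<in> ?G" "S_mon w \<in> ?G" for u w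
    using that unfolding S_mon_append G_def by (rule generate_ring.eng_mult)
  have rep: "S_mon (concat (replicate n u)) \<in> ?G" if "S_mon u \<in> ?G" for n u
    by (induction n) (auto intro: one append that)
  have even: "S_mon (even_word m) \<in> ?G" for m
    by (cases m) (simp only: even_word.simps, intro append rep Y; simp)
  show "range poly_map \<subseteq> ?G"
  proof safe
    fix q :: "(4 \<Rightarrow>\<^sub>0 nat) \<Rightarrow>\<^sub>0 'k"
    show "poly_map q \<in> ?G"
    proof (induction q rule: poly_mapping_single_add_induct)
      case zero
      show ?case unfolding poly_map_zero G_def
        by (rule zero_in_generate)
    next
      case (single_add m k q)
      have "S_scalar k \<in> ?G" unfolding G_def by (intro generate_ring.incl) blast
      with even single_add.IH show ?case
        unfolding poly_map_add poly_map_single G_def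
        by (intro generate_ring.eng_add generate_ring.eng_mult)
    qed
  qed
  have mon: "S_mon (even_word n) \<in> range (poly_map :: _ \<Rightarrow> 'k free_alg set)" for n
  proof -
    obtain m where "coords m = n" using surj_coords by blast
    then have "S_mon (even_word n) = (poly_map (Poly_Mapping.single m 1) :: 'k free_alg set)"
      by (simp add: poly_map_def poly_lift_single S_mon_def)
    then show ?thesis by (rule range_eqI)
  qed
  show "?G \<subseteq> range poly_map"
  proof
    fix x assume "x \<in> ?G"
    then show "x \<in> range poly_map"
      unfolding G_def
    proof induction
      case one
      show ?case by (simp only: rangeI flip: poly_map_one)
    next
      case (incl h)
      \<comment> \<open>The generators are the even words of the four unit vectors, and scalars are
        images of constant polynomials.\<close>
      then show ?case
        using mon[of "(1, 0, 0, 0)"] mon[of "(0, 1, 0, 0)"] mon[of "(0, 0, 1, 0)"]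
          mon[of "(0, 0, 0, 1)"] by (auto simp flip: poly_map_scalar)
    next
      case (a_inv h)
      then show ?case by (auto simp flip: poly_map_uminus)
    next
      case (eng_add h1 h2)
      then show ?case by (auto simp flip: poly_map_add)
    next
      case (eng_mult h1 h2)
      then show ?case by (auto simp flip: poly_map_mult)
    qed
  qed
qed

theorem proposition3p2p10:
  shows "(S_component \<one>\<^bsub>SD16\<^esub> :: 'k::{alg_closed_field, field_char_0} free_alg set set) =
           S_subalgebra_generated
             {S_var X1 [^]\<^bsub>S_ring\<^esub> (2::nat), S_var X2 [^]\<^bsub>S_ring\<^esub> (2::nat),
              S_var X3 \<otimes>\<^bsub>S_ring\<^esub> S_var X4, S_var X4 \<otimes>\<^bsub>S_ring\<^esub> S_var X3}
       \<and> (\<exists>h \<in> ring_iso (S_ring\<lparr>carrier := S_component \<one>\<^bsub>SD16\<^esub>\<rparr>)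
                          (ring_of_type_algebra :: ((4 \<Rightarrow>\<^sub>0 nat) \<Rightarrow>\<^sub>0 'k) ring).
            \<forall>k::'k. h (S_scalar k) = Poly_Mapping.single 0 k)"
proof
  interpret ring "S_ring :: 'k free_alg set ring" by (rule ring_S_ring)
  have prod: "S_var i \<otimes>\<^bsub>S_ring\<^esub> S_var j = (S_mon [i, j] :: 'k free_alg set)" for i j
    by (simp add: S_var_def var_def S_mon_def mult_single plus_list_def)
  have pow: "S_var i [^]\<^bsub>S_ring\<^esub> (2::nat) = (S_mon [i, i] :: 'k free_alg set)" for i
  proof -
    have "S_var i \<in> carrier (S_ring :: 'k free_alg set ring)"
      by (simp add: S_ring_carrier S_var_def)
    then show ?thesis by (simp add: numeral_2_eq_2 prod del: S_ring_ops)
  qed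
  show "(S_component \<one>\<^bsub>SD16\<^esub> :: 'k free_alg set set) =
           S_subalgebra_generated
             {S_var X1 [^]\<^bsub>S_ring\<^esub> (2::nat), S_var X2 [^]\<^bsub>S_ring\<^esub> (2::nat),
              S_var X3 \<otimes>\<^bsub>S_ring\<^esub> S_var X4, S_var X4 \<otimes>\<^bsub>S_ring\<^esub> S_var X3}"
    unfolding pow prod using range_poly_map range_poly_map_eq_generated by metis
  let ?P = "ring_of_type_algebra :: ((4 \<Rightarrow>\<^sub>0 nat) \<Rightarrow>\<^sub>0 'k) ring"
  let ?Se = "S_ring\<lparr>carrier := S_component \<one>\<^bsub>SD16\<^esub>\<rparr> :: 'k free_alg set ring"
  \<comment> \<open>The isomorphism is explicit on polynomials, so it is established in this
    direction and then inverted.\<close>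
  have "poly_map \<in> ring_iso ?P ?Se"
    using inj_poly_map range_poly_map
    by (intro ring_iso_memI)
      (auto simp: poly_map_mult poly_map_add poly_map_one bij_betw_def simp del: S_ring_ops)
  then have "inv_into UNIV poly_map \<in> ring_iso ?Se ?P"
    using ring_iso_set_sym[OF ring_ring_of_type_algebra] by fastforce
  \<comment> \<open>Matching the scalars makes the inverse an isomorphism of
    \<open>'k\<close>-algebras, not merely of rings.\<close>
  moreover have "inv_into UNIV poly_map (S_scalar k) = Poly_Mapping.single 0 k" for k :: 'k
    using inv_f_f[OF inj_poly_map] poly_map_scalar by metis
  ultimately show "\<exists>h \<in> ring_iso ?Se ?P. \<forall>k. h (S_scalar k) = Poly_Mapping.single 0 k"
    by blast
qed

end
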